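(* Let $m$ be a nonnegative integer and $B_1,\ldots,B_m \in \mathbb{S}^n$. Let $\mathbb{K}=\{xx^T : x\in\mathbb{R}^n\}$ and $\mathbb{J}_- = \bigcap_{\ell=1}^m \mathbb{J}_-(B_\ell)$ (with $\mathbb{J}_-=\mathbb{S}^n_+$ if $m=0$). Assume that $$\mathbb{J}_0(B_k) \subseteq \mathbb{J}_- \quad (1 \le k \le m).$$ Then: (i) $\mathbb{J}_- \in \widehat{\mathcal{F}}(\mathbb{K})$. (ii) Let $Q\in\mathbb{S}^n$ and $H\in\mathbb{S}^n$. Then $-\infty < \zeta_p(\mathbb{J}_-,Q,H) = \zeta_p(\mathbb{K}\cap\mathbb{J}_-,Q,H) < \infty$ if and only if $-\infty < \zeta_p(\mathbb{J}_-,Q,H) < \infty$.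
   Context: $\mathbb{S}^n$ is the space of real symmetric $n\times n$ matrices with the trace inner product $\langle A,B\rangle$, and $\mathbb{S}^n_+$ is the cone of positive semidefinite matrices in $\mathbb{S}^n$; $\mathrm{co}$ denotes the convex hull, and $\mathrm{co}\,\mathbb{K}=\mathbb{S}^n_+$. For $B\in\mathbb{S}^n$, $$\mathbb{J}_0(B)=\{X\in\mathbb{S}^n_+:\langle B,X\rangle=0\},\qquad \mathbb{J}_-(B)=\{X\in\mathbb{S}^n_+:\langle B,X\rangle\le 0\}.$$ A cone is a set closed under multiplication by nonnegative scalars. $\widehat{\mathcal{F}}(\mathbb{K})$ is the family of all convex cones $\mathbb{J}\subseteq\mathrm{co}\,\mathbb{K}$ satisfying $\mathrm{co}(\mathbb{K}\cap\mathbb{J})=\mathbb{J}$. For a cone $\mathbb{C}\subseteq\mathbb{S}^n$, $\zeta_p(\mathbb{C},Q,H)=\inf\{\langle Q,X\rangle: X\in\mathbb{C},\ \langle H,X\rangle=1\}$, equal to $\infty$ if the feasible set is empty. Thus $\zeta_p(\mathbb{K}\cap\mathbb{J}_-,Q,H)=\inf\{x^TQx : x\in\mathbb{R}^n,\ x^TB_kx\le 0\ (1\le k\le m),\ x^THx=1\}$ is the optimal value of a quadratically constrained quadratic program, and $\zeta_p(\mathbb{J}_-,Q,H)$ is the optimal value of its semidefinite programming relaxation. *)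

theory Defs
  imports "HOL-Analysis.Analysis"
begin

definition sym_matrices :: "(real^'n^'n) set" where
  "sym_matrices = {A. transpose A = A}"

definition trace_inner :: "real^'n^'n \<Rightarrow> real^'n^'n \<Rightarrow> real" where
  "trace_inner A B = trace (transpose A ** B)"

lemma trace_inner_eq_inner: "trace_inner A B = A \<bullet> B"
proof -
  have "trace_inner A B = (\<Sum>i\<in>UNIV. \<Sum>k\<in>UNIV. A $ k $ i * B $ k $ i)"
    by (simp add: trace_inner_def trace_def matrix_matrix_mult_def transpose_def)
  also have "\<dots> = (\<Sum>k\<in>UNIV. \<Sum>i\<in>UNIV. A $ k $ i * B $ k $ i)"
    by (rule sum.swap)
  also have "\<dots> = A \<bullet> B"
    by (simp add: inner_vec_def)
  finally show ?thesis .
qed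

definition psd_cone :: "(real^'n^'n) set" where
  "psd_cone = {X \<in> sym_matrices. \<forall>v. 0 \<le> v \<bullet> (X *v v)}"

definition rank_one_cone :: "(real^'n^'n) set" where
  "rank_one_cone =
    range (\<lambda>x :: real^'n. (columnvector x :: real^1^'n) ** (rowvector x :: real^'n^1))"

lemma rank_one_cone_eq: "rank_one_cone = range (\<lambda>x :: real^'n. \<chi> i j. x $ i * x $ j)"
  by (simp add: rank_one_cone_def matrix_matrix_mult_def columnvector_def rowvector_def)

definition J_zero :: "real^'n^'n \<Rightarrow> (real^'n^'n) set" where
  "J_zero B = {X \<in> psd_cone. trace_inner B X = 0}"

definition J_nonpos :: "real^'n^'n \<Rightarrow> (real^'n^'n) set" where
  "J_nonpos B = {X \<in> psd_cone. trace_inner B X \<le> 0}"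

text \<open>Intersecting with \<^const>\<open>psd_cone\<close> only matters when \<open>m = 0\<close>: it makes the
  empty intersection the whole positive semidefinite cone.\<close>
definition J_minus :: "nat \<Rightarrow> (nat \<Rightarrow> real^'n^'n) \<Rightarrow> (real^'n^'n) set" where
  "J_minus m B = psd_cone \<inter> (\<Inter>l\<in>{1..m}. J_nonpos (B l))"

text \<open>Here \<^const>\<open>convex_cone\<close> excludes the empty set.\<close>
definition F_hat :: "(real^'n^'n) set \<Rightarrow> (real^'n^'n) set set" where
  "F_hat K = {J. convex_cone J \<and> J \<subseteq> convex hull K \<and> convex hull (K \<inter> J) = J}"

text \<open>The infimum is taken in \<^typ>\<open>ereal\<close>, so it is \<open>\<infinity>\<close> when no \<open>X\<close> is feasible.\<close>
definition zeta_p :: "(real^'n^'n) set \<Rightarrow> real^'n^'n \<Rightarrow> real^'n^'n \<Rightarrow> ereal" where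
  "zeta_p C Q H = (INF X\<in>{X \<in> C. trace_inner H X = 1}. ereal (trace_inner Q X))"

end

theory Submission
  imports Defs
begin

text \<open>
  Write \<open>J\<close> for the feasible cone \<open>J_minus m B\<close> and \<open>K\<close> for the cone of the matrices
  \<open>x x\<^sup>T\<close>. Being positive semidefinite, the elements of \<open>J\<close> are bounded by their trace, so the
  slice of \<open>J\<close> by \<open>trace X = 1\<close> is compact and convex, and it is the convex hull of its
  extreme points. Part (i) therefore holds as soon as every extreme point \<open>X\<close> of the slice has
  rank one. Suppose that the rank of \<open>X\<close> is at least two. Then \<open>X - u u\<^sup>T - v v\<^sup>T\<close> is positive
  semidefinite for some linearly independent \<open>u\<close>, \<open>v\<close> (\<open>psd_split_rank_two\<close>), so
  \<open>X + D\<close> and \<open>X - D\<close> are positive semidefinite for every small \<open>D\<close> in the three-dimensional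
  span of \<open>u u\<^sup>T\<close>, \<open>v v\<^sup>T\<close> and \<open>u v\<^sup>T + v u\<^sup>T\<close>. Three dimensions leave room for two linear
  conditions on a nonzero \<open>D\<close> (\<open>psd_two_sided_perturbation\<close>): one is \<open>trace D = 0\<close>.
  If some \<open>B k\<close> is orthogonal to \<open>X\<close>, the other is \<open>\<langle>B k, D\<rangle> = 0\<close>; then both
  \<open>X + D\<close> and \<open>X - D\<close> lie in \<open>J_zero (B k)\<close>, and the hypothesis puts them into \<open>J\<close>,
  whatever the remaining constraints are. If no \<open>B k\<close> is orthogonal to \<open>X\<close>, all
  constraints are strict at \<open>X\<close> and survive a small perturbation. In both cases \<open>X\<close> is the
  midpoint of two other points of the slice, so it is not extreme
  (\<open>J_minus_two_sided_perturbation\<close>, \<open>convex_hull_rank_one_J_minus\<close>).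

  Part (ii) follows from \<open>J\<close> being the convex hull of the cone \<open>K \<inter> J\<close>. Let \<open>\<eta>\<close> be the optimal
  value over \<open>K \<inter> J\<close>. If the value over \<open>J\<close> is finite, the linear form
  \<open>Y \<mapsto> \<langle>Q - \<eta> H, Y\<rangle>\<close> is nonnegative on \<open>K \<inter> J\<close>, hence on its hull \<open>J\<close>, which says that
  \<open>\<langle>Q, X\<rangle> \<ge> \<eta>\<close> for every feasible \<open>X\<close> in \<open>J\<close> (\<open>conic_bound_extends_to_hull\<close>).
\<close>

section \<open>Outer products and the positive semidefinite cone\<close>

definition outer :: "real^'n \<Rightarrow> real^'n \<Rightarrow> real^'n^'n" where
  "outer u v = (\<chi> i j. u $ i * v $ j)"

lemma outer_mult_vector: "outer u v *v w = (v \<bullet> w) *\<^sub>R u"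
  by (vector outer_def matrix_vector_mult_def inner_vec_def)
     (simp add: sum_distrib_left sum_distrib_right mult_ac)

lemma quadratic_form_eq_inner_outer: "v \<bullet> (X *v v) = X \<bullet> outer v v"
  by (simp add: inner_vec_def matrix_vector_mult_def outer_def sum_distrib_left mult_ac)

lemma transpose_outer: "transpose (outer u v) = outer v u"
  by (vector transpose_def outer_def mult.commute)

lemma transpose_add: "transpose (X + Y) = transpose X + transpose (Y :: real^'n^'n)"
  by (vector transpose_def)

lemma transpose_diff: "transpose (X - Y) = transpose X - transpose (Y :: real^'n^'n)"
  by (vector transpose_def)

lemma transpose_scaleR: "transpose (c *\<^sub>R X) = c *\<^sub>R transpose (X :: real^'n^'n)"
  by (vector transpose_def)

lemma rank_one_cone_eq_outer: "rank_one_cone = range (\<lambda>x. outer x x)"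
  by (simp add: rank_one_cone_eq outer_def)

lemma scaleR_rank_one_cone:
  assumes "X \<in> rank_one_cone" "0 \<le> c"
  shows "c *\<^sub>R X \<in> rank_one_cone"
proof -
  obtain x where "X = outer x x" using assms(1) by (auto simp: rank_one_cone_eq_outer)
  then have "c *\<^sub>R X = outer (sqrt c *\<^sub>R x) (sqrt c *\<^sub>R x)"
    using \<open>0 \<le> c\<close> by (vector outer_def)
  then show ?thesis by (auto simp: rank_one_cone_eq_outer)
qed

lemma zero_in_rank_one_cone: "0 \<in> rank_one_cone"
  using scaleR_rank_one_cone[of "outer 0 0" 0] by (auto simp: rank_one_cone_eq_outer)

lemma psd_coneI: "transpose X = X \<Longrightarrow> (\<And>v. 0 \<le> v \<bullet> (X *v v)) \<Longrightarrow> X \<in> psd_cone"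
  by (simp add: psd_cone_def sym_matrices_def)

lemma psd_coneD:
  assumes "X \<in> psd_cone"
  shows "transpose X = X" and "0 \<le> v \<bullet> (X *v v)"
  using assms by (auto simp: psd_cone_def sym_matrices_def)

lemma psd_form_commute: 
  assumes "X \<in> psd_cone" shows "v \<bullet> (X *v w) = w \<bullet> (X *v v)"
  by (metis assms dot_lmul_matrix inner_commute psd_coneD(1) vector_transpose_matrix)

lemma convex_cone_psd_cone: "convex_cone psd_cone"
  unfolding convex_cone_iff
  by (auto intro!: psd_coneI simp: transpose_add transpose_scaleR psd_coneD
      matrix_vector_mult_add_rdistrib inner_add_right scaleR_matrix_vector_assoc[symmetric])
    (simp add: transpose_def zero_vec_def)

text \<open>The quadratic form of \<open>X\<close> at \<open>v\<close> is linear in \<open>X\<close>, so the cone is an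
  intersection of closed half-spaces and hyperplanes.\<close>
lemma closed_psd_cone: "closed (psd_cone :: (real^'n^'n) set)"
proof -
  have *: "psd_cone = (\<Inter>i j. {X :: real^'n^'n. X $ i $ j = X $ j $ i}) \<inter> (\<Inter>v. {X. 0 \<le> outer v v \<bullet> X})"
    by (auto simp: psd_cone_def sym_matrices_def transpose_def vec_eq_iff
        quadratic_form_eq_inner_outer inner_commute)
  show ?thesis unfolding *
    by (intro closed_Int closed_INT ballI closed_Collect_eq closed_Collect_le continuous_intros)
qed

lemma trace_eq_inner: "X \<bullet> mat 1 = (\<Sum>i\<in>UNIV. X $ i $ i)"
  by (simp add: inner_vec_def mat_def if_distrib[of "(*) _"] cong: if_cong)

text \<open>Evaluating the form at \<open>e\<^sub>i + e\<^sub>j\<close> and \<open>e\<^sub>i - e\<^sub>j\<close> gives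
  \<open>2 \<bar>X\<^sub>i\<^sub>j\<bar> \<le> X\<^sub>i\<^sub>i + X\<^sub>j\<^sub>j\<close>. This makes the slice of trace one bounded, and shows that among
  positive semidefinite matrices only the zero matrix has trace zero.\<close>
lemma psd_entry_le_trace:
  assumes "X \<in> psd_cone"
  shows "\<bar>X $ i $ j\<bar> \<le> X \<bullet> mat 1"
proof -
  have ent: "axis a 1 \<bullet> (X *v axis b 1) = X $ a $ b" for a b
    by (simp add: matrix_vector_mul_component inner_axis' inner_axis)
  have diag: "0 \<le> X $ a $ a" for a
    using psd_coneD(2)[OF assms, of "axis a 1"] by (simp add: ent)
  have le: "X $ a $ a \<le> X \<bullet> mat 1" for a
    unfolding trace_eq_inner by (rule member_le_sum) (auto simp: diag)
  have sym: "X $ j $ i = X $ i $ j"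
    using psd_form_commute[OF assms, of "axis j 1" "axis i 1"] by (simp add: ent)
  have "0 \<le> (axis i 1 + axis j 1) \<bullet> (X *v (axis i 1 + axis j 1))"
    "0 \<le> (axis i 1 - axis j 1) \<bullet> (X *v (axis i 1 - axis j 1))"
    by (rule psd_coneD(2)[OF assms])+
  then show ?thesis
    using le[of i] le[of j]
    by (simp add: matrix_vector_right_distrib matrix_vector_mult_diff_distrib inner_add_left inner_add_right inner_diff_left
        inner_diff_right ent sym)
qed

lemma norm_psd_le_trace:
  fixes X :: "real^'n^'n"
  assumes "X \<in> psd_cone"
  shows "norm X \<le> real CARD('n) * (real CARD('n) * (X \<bullet> mat 1))"
proof -
  have "norm (X $ i) \<le> real CARD('n) * (X \<bullet> mat 1)" for i
    using norm_le_l1_cart[of "X $ i"] sum_bounded_above[of UNIV "\<lambda>j. \<bar>X $ i $ j\<bar>" "X \<bullet> mat 1"]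
      psd_entry_le_trace[OF assms, of i] by force
  then have "(\<Sum>i\<in>UNIV. norm (X $ i)) \<le> real CARD('n) * (real CARD('n) * (X \<bullet> mat 1))"
    using sum_bounded_above[of UNIV "\<lambda>i. norm (X $ i)"] by force
  moreover have "norm X \<le> (\<Sum>i\<in>UNIV. norm (X $ i))"
    by (simp add: norm_vec_def L2_set_le_sum)
  ultimately show ?thesis by linarith
qed

lemma psd_trace_pos:
  assumes "X \<in> psd_cone" "X \<noteq> 0"
  shows "0 < X \<bullet> mat 1"
proof -
  obtain i j where "X $ i $ j \<noteq> 0" using assms(2) by (auto simp: vec_eq_iff)
  then show ?thesis using psd_entry_le_trace[OF assms(1), of i j] by linarith
qed

lemma psd_nonzero_form_pos:
  assumes "X \<in> psd_cone" "X \<noteq> 0"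
  obtains b where "0 < b \<bullet> (X *v b)"
proof -
  have "0 < (\<Sum>i\<in>UNIV. X $ i $ i)"
    using psd_trace_pos[OF assms] by (simp add: trace_eq_inner)
  then obtain i where "0 < X $ i $ i"
    by (meson not_less sum_nonpos)
  then have "0 < axis i 1 \<bullet> (X *v axis i 1)"
    by (simp add: matrix_vector_mul_component inner_axis' inner_axis)
  then show ?thesis ..
qed

section \<open>Two-sided perturbations of matrices of rank at least two\<close>

text \<open>With \<open>u = X a / sqrt (a \<bullet> X a)\<close>, the difference \<open>X - u u\<^sup>T\<close> is a Schur complement:
  its form at \<open>v\<close> is the form of \<open>X\<close> at \<open>v - c a\<close>, where \<open>c\<close> minimises that value. The
  difference is thus positive semidefinite and vanishes at \<open>a\<close>. The last conclusion records that
  \<open>u\<close> is a nonzero multiple of \<open>X a\<close>.\<close>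
lemma psd_split_rank_one:
  assumes X: "X \<in> psd_cone" and s: "0 < a \<bullet> (X *v a)"
  obtains u where "X - outer u u \<in> psd_cone" "(X - outer u u) *v a = 0" "a \<bullet> u \<noteq> 0"
    "\<And>w. w \<bullet> u = 0 \<longleftrightarrow> w \<bullet> (X *v a) = 0"
proof
  let ?s = "a \<bullet> (X *v a)"
  let ?u = "(1 / sqrt ?s) *\<^sub>R (X *v a)"
  have mult: "outer ?u ?u *v w = ((w \<bullet> (X *v a)) / ?s) *\<^sub>R (X *v a)" for w
    using s by (simp add: outer_mult_vector inner_commute[of "X *v a"])
  show "X - outer ?u ?u \<in> psd_cone"
  proof (rule psd_coneI)
    fix v
    define c where "c = v \<bullet> (X *v a) / ?s"
    have cs: "v \<bullet> (X *v a) = c * ?s" using s by (simp add: c_def)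
    have "0 \<le> (v - c *\<^sub>R a) \<bullet> (X *v (v - c *\<^sub>R a))" by (rule psd_coneD(2)[OF X])
    also have "\<dots> = v \<bullet> (X *v v) - c * (c * ?s)"
      by (simp add: matrix_vector_mult_diff_distrib matrix_vector_mult_scaleR inner_diff_left
          inner_diff_right psd_form_commute[OF X, of a v] cs algebra_simps)
    also have "\<dots> = v \<bullet> ((X - outer ?u ?u) *v v)"
      by (simp add: matrix_vector_mult_diff_rdistrib mult inner_diff_right cs)
    finally show "0 \<le> v \<bullet> ((X - outer ?u ?u) *v v)" .
  qed (simp add: transpose_diff transpose_outer psd_coneD(1)[OF X])
  show "(X - outer ?u ?u) *v a = 0"
    using s by (simp add: matrix_vector_mult_diff_rdistrib mult)
  show "a \<bullet> ?u \<noteq> 0" using s by simp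
  show "w \<bullet> ?u = 0 \<longleftrightarrow> w \<bullet> (X *v a) = 0" for w using s by auto
qed

text \<open>Splitting off a rank-one part twice works because the remainder after the first step is
  nonzero. The second vector lies in the range of the first remainder, which is orthogonal to \<open>a\<close>;
  so \<open>a\<close> witnesses that \<open>u\<close> and \<open>v\<close> are linearly independent.\<close>
lemma psd_split_rank_two:
  assumes X: "X \<in> psd_cone" and nr: "X \<notin> rank_one_cone"
  obtains u v a where "X - outer u u - outer v v \<in> psd_cone" "a \<bullet> u \<noteq> 0" "a \<bullet> v = 0" "v \<noteq> 0"
proof -
  have "X \<noteq> 0" using nr zero_in_rank_one_cone by auto
  then obtain a where "0 < a \<bullet> (X *v a)" using psd_nonzero_form_pos[OF X] by blast
  then obtain u where u: "X - outer u u \<in> psd_cone" "(X - outer u u) *v a = 0" "a \<bullet> u \<noteq> 0"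
    using psd_split_rank_one[OF X] by metis
  let ?Y = "X - outer u u"
  have "?Y \<noteq> 0" using nr by (auto simp: rank_one_cone_eq_outer)
  then obtain b where b: "0 < b \<bullet> (?Y *v b)" using psd_nonzero_form_pos[OF u(1)] by blast
  then obtain v where v: "?Y - outer v v \<in> psd_cone" "b \<bullet> v \<noteq> 0"
    "\<And>w. w \<bullet> v = 0 \<longleftrightarrow> w \<bullet> (?Y *v b) = 0"
    using psd_split_rank_one[OF u(1)] by metis
  have "a \<bullet> (?Y *v b) = 0"
    by (simp add: psd_form_commute[OF u(1), of a b] u(2))
  then have "a \<bullet> v = 0" by (simp only: v(3))
  moreover have "v \<noteq> 0" using v(2) by auto
  ultimately show ?thesis using that[OF v(1) u(3)] by blast
qed

text \<open>The perturbations \<open>\<alpha> u u\<^sup>T + \<beta> v v\<^sup>T + \<gamma> (u v\<^sup>T + v u\<^sup>T)\<close> form a three-dimensional space,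
  so two orthogonality conditions leave a nonzero one. If the coefficients are at most \<open>1/2\<close> in
  absolute value, its form is dominated by that of \<open>u u\<^sup>T + v v\<^sup>T\<close>, which \<open>X\<close> dominates.\<close>
lemma psd_two_sided_perturbation:
  fixes X :: "real^'n^'n"
  assumes X: "X \<in> psd_cone" and nr: "X \<notin> rank_one_cone"
  obtains D where "D \<noteq> 0" "B \<bullet> D = 0" "C \<bullet> D = 0" "X + D \<in> psd_cone" "X - D \<in> psd_cone"
proof -
  obtain u v a where uv: "X - outer u u - outer v v \<in> psd_cone" "a \<bullet> u \<noteq> 0" "a \<bullet> v = 0" "v \<noteq> 0"
    using psd_split_rank_two[OF X nr] .
  define D :: "real^3 \<Rightarrow> real^'n^'n" where
    "D c = c$1 *\<^sub>R outer u u + c$2 *\<^sub>R outer v v + c$3 *\<^sub>R (outer u v + outer v u)" for c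
  \<comment> \<open>The coordinate vector of the restriction of \<open>M\<close>, as a linear form, to this space.\<close>
  define coeffs :: "real^'n^'n \<Rightarrow> real^3" where
    "coeffs M = vector [M \<bullet> outer u u, M \<bullet> outer v v, M \<bullet> (outer u v + outer v u)]" for M
  have inner_D: "M \<bullet> D c = coeffs M \<bullet> c" for M c
    by (simp add: D_def coeffs_def inner_vec_def[of "vector _"] sum_3 inner_add_right)
  have "dim {coeffs B, coeffs C} \<le> card {coeffs B, coeffs C}"
    by (rule dim_le_card') simp
  also have "\<dots> \<le> 2" by (simp add: card_insert_if)
  finally have "dim {coeffs B, coeffs C} < DIM(real^3)" by simp
  then obtain c0 where c0: "c0 \<noteq> 0" "span {coeffs B, coeffs C} \<subseteq> {x. c0 \<bullet> x = 0}"
    using lowdim_subset_hyperplane by blast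
  have c0': "coeffs B \<bullet> c0 = 0" "coeffs C \<bullet> c0 = 0"
    using c0(2) span_superset[of "{coeffs B, coeffs C}"] by (auto simp: inner_commute)
  define c where "c = (1 / (2 * norm c0)) *\<^sub>R c0"
  have c_le: "\<bar>c $ i\<bar> \<le> 1/2" for i
    using component_le_norm_cart[of c i] c0(1) by (simp add: c_def)
  have D_mult: "D c *v w = (c$1 * (u \<bullet> w) + c$3 * (v \<bullet> w)) *\<^sub>R u + (c$2 * (v \<bullet> w) + c$3 * (u \<bullet> w)) *\<^sub>R v" for w
    by (simp add: D_def matrix_vector_mult_add_rdistrib scaleR_matrix_vector_assoc[symmetric] outer_mult_vector
        algebra_simps)
  have D_form: "\<bar>w \<bullet> (D c *v w)\<bar> \<le> (u \<bullet> w)\<^sup>2 + (v \<bullet> w)\<^sup>2" for w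
  proof -
    let ?p = "u \<bullet> w" and ?q = "v \<bullet> w"
    have half: "\<bar>c$i * t\<bar> \<le> 1/2 * \<bar>t\<bar>" for i t
      using mult_right_mono[OF c_le[of i], of "\<bar>t\<bar>"] by (simp add: abs_mult)
    have "w \<bullet> (D c *v w) = c$1 * ?p\<^sup>2 + c$2 * ?q\<^sup>2 + c$3 * (2 * ?p * ?q)"
      unfolding D_mult by (simp add: inner_add_right inner_commute[of w] power2_eq_square algebra_simps)
    moreover have "\<bar>2 * ?p * ?q\<bar> \<le> ?p\<^sup>2 + ?q\<^sup>2"
      using sum_squares_bound[of ?p ?q] sum_squares_bound[of ?p "- ?q"] by simp
    ultimately show ?thesis
      using half[of 1 "?p\<^sup>2"] half[of 2 "?q\<^sup>2"] half[of 3 "2 * ?p * ?q"] by simp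
  qed
  have rest: "(u \<bullet> w)\<^sup>2 + (v \<bullet> w)\<^sup>2 \<le> w \<bullet> (X *v w)" for w
    using psd_coneD(2)[OF uv(1), of w]
    by (simp add: matrix_vector_mult_diff_rdistrib outer_mult_vector inner_diff_right
        inner_commute[of w] power2_eq_square)
  have D_sym: "transpose (D c) = D c"
    by (simp add: D_def transpose_add transpose_scaleR transpose_outer add.commute)
  show ?thesis
  proof
    show "D c \<noteq> 0"
    proof
      assume D0: "D c = 0"
      have u0: "u \<noteq> 0" using uv(2) by auto
      have "D c *v a = 0" by (simp add: D0)
      then have eq: "(c$1 * (u \<bullet> a)) *\<^sub>R u + (c$3 * (u \<bullet> a)) *\<^sub>R v = 0"
        using uv(3) by (simp add: D_mult inner_commute)
      from arg_cong[OF eq, of "\<lambda>x. a \<bullet> x"] have "c$1 = 0"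
        using uv(2,3) by (simp add: inner_add_right inner_commute)
      with eq have "c$3 = 0" using uv(2,4) by (simp add: inner_commute)
      have "D c *v v = 0" by (simp add: D0)
      then have "c$2 = 0"
        using \<open>c$1 = 0\<close> \<open>c$3 = 0\<close> uv(4) by (simp add: D_mult)
      then have "c = 0" using \<open>c$1 = 0\<close> \<open>c$3 = 0\<close> by (simp add: vec_eq_iff forall_3)
      then show False using c0(1) by (simp add: c_def)
    qed
    show "B \<bullet> D c = 0" "C \<bullet> D c = 0" using c0' by (simp_all add: inner_D c_def)
    show "X + D c \<in> psd_cone"
    proof (rule psd_coneI)
      show "transpose (X + D c) = X + D c"
        by (simp add: transpose_add D_sym psd_coneD(1)[OF X])
      show "0 \<le> w \<bullet> ((X + D c) *v w)" for w
        using D_form[of w] rest[of w]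
        by (simp add: matrix_vector_mult_add_rdistrib inner_add_right)
    qed
    show "X - D c \<in> psd_cone"
    proof (rule psd_coneI)
      show "transpose (X - D c) = X - D c"
        by (simp add: transpose_diff D_sym psd_coneD(1)[OF X])
      show "0 \<le> w \<bullet> ((X - D c) *v w)" for w
        using D_form[of w] rest[of w]
        by (simp add: matrix_vector_mult_diff_rdistrib inner_diff_right)
    qed
  qed
qed

section \<open>The feasible cone is generated by its rank-one matrices\<close>

lemma J_zero_eq: "J_zero B = {X \<in> psd_cone. B \<bullet> X = 0}"
  by (simp add: J_zero_def trace_inner_eq_inner)

lemma J_minus_eq: "J_minus m B = psd_cone \<inter> (\<Inter>k\<in>{1..m}. {X. B k \<bullet> X \<le> 0})"
  by (auto simp: J_minus_def J_nonpos_def trace_inner_eq_inner)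

lemma convex_cone_J_minus: "convex_cone (J_minus m B)"
  using convex_cone_psd_cone
  by (auto simp: J_minus_eq convex_cone_iff inner_add_right mult_nonneg_nonpos add_nonpos_nonpos)

lemma closed_J_minus: "closed (J_minus m B)"
  unfolding J_minus_eq by (intro closed_Int closed_INT ballI closed_psd_cone closed_halfspace_le)

text \<open>This is where the hypothesis on \<open>J_zero\<close> enters: at a point with a tight constraint it
  suffices to preserve that single constraint as an equation, which costs only one linear
  condition, however many constraints there are. The condition \<open>D \<bullet> mat 1 = 0\<close> keeps the trace.\<close>
lemma J_minus_two_sided_perturbation:
  fixes B :: "nat \<Rightarrow> real^'n^'n"
  assumes tight: "\<And>k. k \<in> {1..m} \<Longrightarrow> J_zero (B k) \<subseteq> J_minus m B"
    and X: "X \<in> J_minus m B" and nr: "X \<notin> rank_one_cone"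
  obtains D where "D \<noteq> 0" "D \<bullet> mat 1 = 0" "X + D \<in> J_minus m B" "X - D \<in> J_minus m B"
proof -
  have Xpsd: "X \<in> psd_cone" using X by (simp add: J_minus_eq)
  show ?thesis
  proof (cases "\<exists>k\<in>{1..m}. B k \<bullet> X = 0")
    case True
    then obtain k where k: "k \<in> {1..m}" "B k \<bullet> X = 0" by blast
    obtain D where D: "D \<noteq> 0" "B k \<bullet> D = 0" "mat 1 \<bullet> D = 0" "X + D \<in> psd_cone" "X - D \<in> psd_cone"
      using psd_two_sided_perturbation[OF Xpsd nr] .
    then have "X + D \<in> J_zero (B k)" "X - D \<in> J_zero (B k)"
      using k by (auto simp: J_zero_eq inner_add_right inner_diff_right)
    then show ?thesis using that D tight[OF k(1)] by (auto simp: inner_commute)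
  next
    case False
    then have strict: "B k \<bullet> X < 0" if "k \<in> {1..m}" for k
      using X that by (force simp: J_minus_eq)
    \<comment> \<open>Only the trace has to be preserved here; shrinking \<open>D\<close> keeps the strict constraints.\<close>
    obtain D where D: "D \<noteq> 0" "mat 1 \<bullet> D = 0" "X + D \<in> psd_cone" "X - D \<in> psd_cone"
      using psd_two_sided_perturbation[OF Xpsd nr] by metis
    have "eventually (\<lambda>e. B k \<bullet> X + e * \<bar>B k \<bullet> D\<bar> < 0) (at_right 0)" if "k \<in> {1..m}" for k
      by (rule order_tendstoD(2)[OF _ strict[OF that]]) (auto intro!: tendsto_eq_intros)
    then have "eventually (\<lambda>e. \<forall>k\<in>{1..m}. B k \<bullet> X + e * \<bar>B k \<bullet> D\<bar> < 0) (at_right 0)"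
      by (intro eventually_ball_finite) auto
    moreover have "eventually (\<lambda>e::real. 0 < e \<and> e < 1) (at_right 0)"
      by (auto simp: eventually_at_right_field intro: exI[of _ 1])
    ultimately
    have "eventually (\<lambda>e. (\<forall>k\<in>{1..m}. B k \<bullet> X + e * \<bar>B k \<bullet> D\<bar> < 0) \<and> 0 < e \<and> e < 1) (at_right 0)"
      by (rule eventually_conj)
    then obtain e where e: "\<forall>k\<in>{1..m}. B k \<bullet> X + e * \<bar>B k \<bullet> D\<bar> < 0" "0 < e" "e < 1"
      using eventually_happens'[OF trivial_limit_at_right_real] by blast
    have mem: "X + e *\<^sub>R E \<in> J_minus m B" if E: "X + E \<in> psd_cone" "E = D \<or> E = - D" for E
    proof -
      have "(1 - e) *\<^sub>R X + e *\<^sub>R (X + E) \<in> psd_cone"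
        using e(2,3)
        by (intro convex_cone_add convex_cone_scaleR convex_cone_psd_cone Xpsd E(1)) auto
      then have "X + e *\<^sub>R E \<in> psd_cone" by (simp add: algebra_simps)
      moreover have "B k \<bullet> (X + e *\<^sub>R E) \<le> 0" if "k \<in> {1..m}" for k
      proof -
        have "e * (B k \<bullet> E) \<le> e * \<bar>B k \<bullet> D\<bar>"
          using E(2) e(2) by (intro mult_left_mono) auto
        then show ?thesis using e(1) that by (fastforce simp: inner_add_right)
      qed
      ultimately show ?thesis by (simp add: J_minus_eq)
    qed
    show ?thesis
    proof
      show "e *\<^sub>R D \<noteq> 0" "(e *\<^sub>R D) \<bullet> mat 1 = 0" using D e by (auto simp: inner_commute)
      show "X + e *\<^sub>R D \<in> J_minus m B" "X - e *\<^sub>R D \<in> J_minus m B"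
        using mem[of D] mem[of "- D"] D by auto
    qed
  qed
qed

text \<open>Krein--Milman on the slice of trace one, followed by scaling. The zero matrix has no
  multiple in the slice; it is itself of the form \<open>x x\<^sup>T\<close>.\<close>
lemma convex_hull_rank_one_J_minus:
  fixes B :: "nat \<Rightarrow> real^'n^'n"
  assumes tight: "\<And>k. k \<in> {1..m} \<Longrightarrow> J_zero (B k) \<subseteq> J_minus m B"
  shows "convex hull (rank_one_cone \<inter> J_minus m B) = J_minus m B"
proof
  let ?J = "J_minus m B" and ?K = "rank_one_cone \<inter> J_minus m B"
  define S where "S = ?J \<inter> {X. mat 1 \<bullet> X = 1}"
  show "convex hull ?K \<subseteq> ?J"
    using convex_cone_J_minus[of m B] by (intro hull_minimal) (auto simp: convex_cone_def)
  have "bounded S"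
    unfolding bounded_iff
  proof (intro exI ballI)
    fix X assume "X \<in> S"
    then show "norm X \<le> real CARD('n) * (real CARD('n) * 1)"
      using norm_psd_le_trace[of X] by (auto simp: S_def J_minus_eq inner_commute)
  qed
  then have "compact S"
    by (simp add: compact_eq_bounded_closed S_def closed_Int closed_J_minus closed_hyperplane)
  moreover have "convex S"
    using convex_cone_J_minus[of m B]
    by (simp add: S_def convex_Int convex_hyperplane convex_cone_def)
  ultimately have S: "S = convex hull {X. X extreme_point_of S}"
    by (rule Krein_Milman_Minkowski)
  have "X \<in> ?K" if "X extreme_point_of S" for X
  proof (rule ccontr)
    assume "X \<notin> ?K"
    have XS: "X \<in> S" using that by (simp add: extreme_point_of_def)
    then obtain D where D: "D \<noteq> 0" "D \<bullet> mat 1 = 0" "X + D \<in> ?J" "X - D \<in> ?J"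
      using J_minus_two_sided_perturbation[OF tight] \<open>X \<notin> ?K\<close> unfolding S_def by blast
    then have mem: "X + D \<in> S" "X - D \<in> S"
      using XS by (auto simp: S_def inner_add_right inner_diff_right inner_commute)
    have "X - D \<noteq> X + D"
    proof
      assume "X - D = X + D"
      then have "2 *\<^sub>R D = 0" by (simp add: scaleR_2 algebra_simps)
      then show False using D(1) by simp
    qed
    moreover have "X = midpoint (X - D) (X + D)"
      by (simp add: midpoint_def flip: scaleR_2)
    ultimately have "X \<in> open_segment (X - D) (X + D)"
      by (metis midpoint_in_open_segment)
    then show False using that mem by (auto simp: extreme_point_of_def)
  qed
  then have S_sub: "S \<subseteq> convex hull ?K"
    by (subst S) (auto intro!: hull_mono)
  have "cone ?K"
    using convex_cone_J_minus[of m B] scaleR_rank_one_cone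
    by (auto simp: cone_def convex_cone_iff)
  then have hull_cone: "c *\<^sub>R X \<in> convex hull ?K" if "X \<in> convex hull ?K" "0 \<le> c" for c X
    using cone_convex_hull[OF \<open>cone ?K\<close>] that unfolding cone_def by blast
  show "?J \<subseteq> convex hull ?K"
  proof
    fix X assume X: "X \<in> ?J"
    show "X \<in> convex hull ?K"
    proof (cases "X = 0")
      case True
      then show ?thesis using X zero_in_rank_one_cone by (auto intro: hull_inc)
    next
      case False
      define t where "t = X \<bullet> mat 1"
      have t: "0 < t" using psd_trace_pos[OF _ False] X by (auto simp: t_def J_minus_eq)
      have "(1 / t) *\<^sub>R X \<in> ?J"
        using t by (intro convex_cone_scaleR[OF convex_cone_J_minus] X) simp
      then have "(1 / t) *\<^sub>R X \<in> S"
        using t by (simp add: S_def t_def inner_commute)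
      then have "t *\<^sub>R (1 / t) *\<^sub>R X \<in> convex hull ?K"
        using hull_cone[OF subsetD[OF S_sub]] t by (meson less_imp_le)
      then show ?thesis using t by simp
    qed
  qed
qed

section \<open>Equality of the optimal values\<close>

text \<open>Otherwise the objective would tend to \<open>-\<infinity>\<close> along the feasible ray \<open>X + t Y\<close>.\<close>
lemma recession_objective_nonneg:
  fixes J :: "'a::real_inner set"
  assumes J: "convex_cone J"
    and bound: "\<And>Z. Z \<in> J \<Longrightarrow> H \<bullet> Z = 1 \<Longrightarrow> z \<le> Q \<bullet> Z"
    and X: "X \<in> J" "H \<bullet> X = 1" and Y: "Y \<in> J" "H \<bullet> Y = 0"
  shows "0 \<le> Q \<bullet> Y"
proof (rule ccontr)
  assume neg: "\<not> 0 \<le> Q \<bullet> Y"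
  \<comment> \<open>At this \<open>t\<close> the objective equals \<open>z - 1\<close>.\<close>
  define t where "t = (Q \<bullet> X - z + 1) / (- (Q \<bullet> Y))"
  have "0 \<le> t" unfolding t_def using bound[OF X] neg by (intro divide_nonneg_pos) auto
  then have "X + t *\<^sub>R Y \<in> J" using J X(1) Y(1) by (simp add: convex_cone_add convex_cone_scaleR)
  then have "z \<le> Q \<bullet> (X + t *\<^sub>R Y)" using X(2) Y(2) by (intro bound) (simp_all add: inner_add_right)
  moreover have "t * (Q \<bullet> Y) = - (Q \<bullet> X - z + 1)" using neg by (simp add: t_def field_simps)
  ultimately show False by (simp add: inner_add_right)
qed

text \<open>It suffices that \<open>Q \<bullet> Y \<ge> \<eta> (H \<bullet> Y)\<close> on \<open>K\<close>, as this half-space then contains the hull.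
  Let \<open>h = H \<bullet> Y\<close>. If \<open>h > 0\<close>, scale \<open>Y\<close> to be feasible; if \<open>h = 0\<close>, \<open>Y\<close> is a recession
  direction. If \<open>h < 0\<close>, then \<open>Y - h Z\<close> is a recession direction for each feasible \<open>Z\<close> in \<open>K\<close>, so
  \<open>(Q \<bullet> Y) / h\<close> is a lower bound of the objective on the feasible part of \<open>K\<close>; the largest lower
  bound \<open>\<eta>\<close> is at least that.\<close>
lemma conic_bound_extends_to_hull:
  fixes J :: "'a::real_inner set"
  assumes J: "convex_cone J" and K: "conic K" and hull: "convex hull K = J"
    and bound: "\<And>Z. Z \<in> J \<Longrightarrow> H \<bullet> Z = 1 \<Longrightarrow> z \<le> Q \<bullet> Z"
    and eta: "\<And>Y. Y \<in> K \<Longrightarrow> H \<bullet> Y = 1 \<Longrightarrow> \<eta> \<le> Q \<bullet> Y"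
    and eta_greatest: "\<And>y. (\<And>Y. Y \<in> K \<Longrightarrow> H \<bullet> Y = 1 \<Longrightarrow> y \<le> Q \<bullet> Y) \<Longrightarrow> y \<le> \<eta>"
    and X: "X \<in> J" "H \<bullet> X = 1"
  shows "\<eta> \<le> Q \<bullet> X"
proof -
  have KJ: "K \<subseteq> J" using hull hull_subset[of K convex] by simp
  have "0 \<le> (Q - \<eta> *\<^sub>R H) \<bullet> Y" if Y: "Y \<in> K" for Y
  proof -
    let ?h = "H \<bullet> Y"
    consider "?h > 0" | "?h = 0" | "?h < 0" by linarith
    then show ?thesis
    proof cases
      case 1
      have "(1 / ?h) *\<^sub>R Y \<in> K" using K Y 1 by (simp add: conicD)
      then have "\<eta> \<le> Q \<bullet> ((1 / ?h) *\<^sub>R Y)" using 1 by (intro eta) auto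
      then show ?thesis using 1 by (simp add: inner_diff_left field_simps)
    next
      case 2
      then show ?thesis
        using recession_objective_nonneg[OF J bound X _ 2] Y KJ by (auto simp: inner_diff_left)
    next
      case 3
      have "(Q \<bullet> Y) / ?h \<le> \<eta>"
      proof (rule eta_greatest)
        fix Z assume Z: "Z \<in> K" "H \<bullet> Z = 1"
        have "Y + (- ?h) *\<^sub>R Z \<in> J"
          using J Y Z KJ 3 by (intro convex_cone_add convex_cone_scaleR) auto
        then have "0 \<le> Q \<bullet> (Y + (- ?h) *\<^sub>R Z)"
          using Z(2) by (intro recession_objective_nonneg[OF J bound X]) (auto simp: inner_add_right inner_diff_right)
        then show "(Q \<bullet> Y) / ?h \<le> Q \<bullet> Z"
          using 3 by (simp add: inner_add_right inner_diff_right field_simps)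
      qed
      then show ?thesis using 3 by (simp add: inner_diff_left field_simps)
    qed
  qed
  then have "J \<subseteq> {Z. 0 \<le> (Q - \<eta> *\<^sub>R H) \<bullet> Z}"
    using hull_minimal[of K "{Z. 0 \<le> (Q - \<eta> *\<^sub>R H) \<bullet> Z}" convex] convex_halfspace_ge[of 0 "Q - \<eta> *\<^sub>R H"]
    by (auto simp: hull)
  then show ?thesis using X by (auto simp: inner_diff_left)
qed

text \<open>The value over \<open>K\<close> must first be seen to be a real number. It is bounded below by the value
  over \<open>J\<close>; and \<open>K\<close> has a feasible point, as \<open>H\<close> would otherwise be nonpositive on \<open>K\<close> and
  hence on its hull \<open>J\<close>, against feasibility over \<open>J\<close>.\<close>
lemma zeta_p_hull_eq:
  fixes J K :: "(real^'n^'n) set"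
  assumes J: "convex_cone J" and K: "conic K" and hull: "convex hull K = J"
    and fin: "- \<infinity> < zeta_p J Q H" "zeta_p J Q H < \<infinity>"
  shows "zeta_p J Q H = zeta_p K Q H"
proof (rule antisym)
  have KJ: "K \<subseteq> J" using hull hull_subset[of K convex] by simp
  then show le: "zeta_p J Q H \<le> zeta_p K Q H"
    unfolding zeta_p_def by (intro INF_superset_mono) auto
  obtain z where z: "zeta_p J Q H = ereal z" using fin by (cases "zeta_p J Q H") auto
  have bound: "z \<le> Q \<bullet> Z" if "Z \<in> J" "H \<bullet> Z = 1" for Z
    using INF_lower[of Z "{X \<in> J. trace_inner H X = 1}" "\<lambda>X. ereal (trace_inner Q X)"] that z
    by (simp add: zeta_p_def trace_inner_eq_inner)
  have "\<exists>X\<in>J. H \<bullet> X = 1"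
    using fin(2) unfolding zeta_p_def INF_less_iff by (auto simp: trace_inner_eq_inner)
  then obtain X0 where X0: "X0 \<in> J" "H \<bullet> X0 = 1" by blast
  have "\<exists>Y\<in>K. 0 < H \<bullet> Y"
  proof (rule ccontr)
    assume "\<not> ?thesis"
    then have "J \<subseteq> {Z. H \<bullet> Z \<le> 0}"
      unfolding hull[symmetric] by (intro hull_minimal) (auto simp: convex_halfspace_le not_less)
    then show False using X0 by auto
  qed
  then obtain Y where Y: "Y \<in> K" "0 < H \<bullet> Y" by blast
  define Y1 where "Y1 = (1 / (H \<bullet> Y)) *\<^sub>R Y"
  have Y1: "Y1 \<in> K" "H \<bullet> Y1 = 1" using K Y by (auto simp: Y1_def conicD)
  have zK: "zeta_p K Q H \<le> Q \<bullet> Y" if "Y \<in> K" "H \<bullet> Y = 1" for Y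
    using INF_lower[of Y "{X \<in> K. trace_inner H X = 1}" "\<lambda>X. ereal (trace_inner Q X)"] that
    by (simp add: zeta_p_def trace_inner_eq_inner)
  obtain \<eta> where \<eta>: "zeta_p K Q H = ereal \<eta>"
    using zK[OF Y1] le z by (cases "zeta_p K Q H") auto
  have greatest: "y \<le> \<eta>" if "\<And>Y. Y \<in> K \<Longrightarrow> H \<bullet> Y = 1 \<Longrightarrow> y \<le> Q \<bullet> Y" for y
  proof -
    have "ereal y \<le> zeta_p K Q H"
      using that unfolding zeta_p_def by (intro INF_greatest) (auto simp: trace_inner_eq_inner)
    then show ?thesis by (simp add: \<eta>)
  qed
  have "\<eta> \<le> Q \<bullet> X" if "X \<in> J" "H \<bullet> X = 1" for X
    using conic_bound_extends_to_hull[OF J K hull bound _ greatest that] zK \<eta> by simp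
  then show "zeta_p K Q H \<le> zeta_p J Q H"
    unfolding \<eta> unfolding zeta_p_def by (intro INF_greatest) (auto simp: trace_inner_eq_inner)
qed

theorem theorem4p1:
  fixes m :: nat and B :: "nat \<Rightarrow> real^'n^'n"
  assumes "\<And>k. k \<in> {1..m} \<Longrightarrow> B k \<in> sym_matrices"
    and "\<And>k. k \<in> {1..m} \<Longrightarrow> J_zero (B k) \<subseteq> J_minus m B"
  shows "J_minus m B \<in> F_hat rank_one_cone \<and>
    (\<forall>Q\<in>sym_matrices. \<forall>H\<in>sym_matrices.
      (- \<infinity> < zeta_p (J_minus m B) Q H \<and>
        zeta_p (J_minus m B) Q H = zeta_p (rank_one_cone \<inter> J_minus m B) Q H \<and>
        zeta_p (rank_one_cone \<inter> J_minus m B) Q H < \<infinity>)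
      \<longleftrightarrow> (- \<infinity> < zeta_p (J_minus m B) Q H \<and> zeta_p (J_minus m B) Q H < \<infinity>))"
proof -
  have hull: "convex hull (rank_one_cone \<inter> J_minus m B) = J_minus m B"
    by (rule convex_hull_rank_one_J_minus[OF assms(2)])
  then have "J_minus m B \<subseteq> convex hull rank_one_cone"
    using hull_mono[of "rank_one_cone \<inter> J_minus m B" rank_one_cone convex] by simp
  then have "J_minus m B \<in> F_hat rank_one_cone"
    unfolding F_hat_def using convex_cone_J_minus[of m B] hull by blast
  moreover have conic: "conic (rank_one_cone \<inter> J_minus m B)"
    using convex_cone_J_minus[of m B] scaleR_rank_one_cone
    by (auto simp: conic_def convex_cone_iff)
  ultimately show ?thesis
    using zeta_p_hull_eq[OF convex_cone_J_minus conic hull] by metis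
qed

end
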